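(* The proof system ${\bf M^\Delta}$ (monotone contingency logic) is strongly complete with respect to the class of all $(m)$-frames, i.e. the class of all neighborhood frames $\langle S,N\rangle$ such that, for every $s\in S$, $X\in N(s)$ and $X\subseteq Y\subseteq S$ imply $Y\in N(s)$.
   Context: Fix a nonempty set $\mathbf{P}$ of propositional variables. The language $\mathcal{L}(\Delta)$ is given by $\varphi::=p\in\mathbf{P}\mid\neg\varphi\mid\varphi\land\varphi\mid\Delta\varphi$; $\vee,\to,\leftrightarrow,\top$ are the usual abbreviations. A neighborhood frame is a pair $\langle S,N\rangle$ with $S$ a nonempty set and $N:S\to\mathcal{P}(\mathcal{P}(S))$; a neighborhood model $\mathcal{M}=\langle S,N,V\rangle$ adds a valuation $V$ assigning a set $V(p)\subseteq S$ to each $p\in\mathbf{P}$. Truth: $\mathcal{M},s\vDash p$ iff $s\in V(p)$; Boolean clauses as usual; $\mathcal{M},s\vDash\Delta\varphi$ iff $\varphi^{\mathcal{M}}\in N(s)$ or $S\setminus\varphi^{\mathcal{M}}\in N(s)$, where $\varphi^{\mathcal{M}}=\{s\in S\mid\mathcal{M},s\vDash\varphi\}$. The system ${\bf M^\Delta}$ has as axioms all instances of propositional tautologies (TAUT), $\Delta\text{Equ}$: $\Delta\varphi\leftrightarrow\Delta\neg\varphi$, and $\Delta\text{M}$: $\Delta\varphi\to\Delta(\varphi\vee\psi)\vee\Delta(\neg\varphi\vee\chi)$; its rules are MP (from $\varphi$ and $\varphi\to\psi$ infer $\psi$) and $\text{RE}\Delta$ (from $\varphi\leftrightarrow\psi$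 infer $\Delta\varphi\leftrightarrow\Delta\psi$). All axioms are schemas. A set $\Gamma$ of formulas is consistent in a system $\Lambda$ if there are no $\gamma_1,\dots,\gamma_n\in\Gamma$ such that $\neg(\gamma_1\land\dots\land\gamma_n)$ is a theorem of $\Lambda$. $\Lambda$ is strongly complete with respect to a class $\mathbb{K}$ of frames if every $\Lambda$-consistent set of formulas is satisfied (all members true) at some state of some model based on a frame in $\mathbb{K}$. *)

theory Defs
  imports Main
begin

text \<open>
  The nonempty set of propositional variables is the type \<^typ>\<open>'p\<close>
  (every HOL type is nonempty, and no assumption on its cardinality is made).
\<close>

datatype 'p fm =
    Atom 'p
  | Neg "'p fm"
  | Con "'p fm" "'p fm"  (infixr "\<^bold>\<and>" 65)
  | Delta "'p fm"

notation Neg ("\<^bold>\<not> _" [75] 75)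
notation Delta ("\<^bold>\<Delta> _" [75] 75)

abbreviation Dis :: "'p fm \<Rightarrow> 'p fm \<Rightarrow> 'p fm"  (infixr "\<^bold>\<or>" 60)
  where "\<phi> \<^bold>\<or> \<psi> \<equiv> \<^bold>\<not> (\<^bold>\<not> \<phi> \<^bold>\<and> \<^bold>\<not> \<psi>)"

abbreviation Imp :: "'p fm \<Rightarrow> 'p fm \<Rightarrow> 'p fm"  (infixr "\<^bold>\<longrightarrow>" 55)
  where "\<phi> \<^bold>\<longrightarrow> \<psi> \<equiv> \<^bold>\<not> (\<phi> \<^bold>\<and> \<^bold>\<not> \<psi>)"

abbreviation Iff :: "'p fm \<Rightarrow> 'p fm \<Rightarrow> 'p fm"  (infixr "\<^bold>\<longleftrightarrow>" 50)
  where "\<phi> \<^bold>\<longleftrightarrow> \<psi> \<equiv> (\<phi> \<^bold>\<longrightarrow> \<psi>) \<^bold>\<and> (\<psi> \<^bold>\<longrightarrow> \<phi>)"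


subsection \<open>Neighborhood semantics\<close>

type_synonym 's nframe = "'s set \<times> ('s \<Rightarrow> 's set set)"

text \<open>
  Frames carry an explicit domain \<open>S\<close>; the values of \<open>N\<close> outside \<open>S\<close> are irrelevant.
\<close>

definition nbhd_frames :: "'s nframe set"
  where "nbhd_frames = {(S, N). S \<noteq> {} \<and> (\<forall>s\<in>S. N s \<subseteq> Pow S)}"

definition m_frames :: "'s nframe set"
  where "m_frames = {(S, N). (S, N) \<in> nbhd_frames \<and>
    (\<forall>s\<in>S. \<forall>X Y. X \<in> N s \<and> X \<subseteq> Y \<and> Y \<subseteq> S \<longrightarrow> Y \<in> N s)}"

definition valuation_on :: "'s set \<Rightarrow> ('p \<Rightarrow> 's set) \<Rightarrow> bool"
  where "valuation_on S V \<longleftrightarrow> (\<forall>p. V p \<subseteq> S)"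

primrec truth :: "'s set \<Rightarrow> ('s \<Rightarrow> 's set set) \<Rightarrow> ('p \<Rightarrow> 's set) \<Rightarrow> 's \<Rightarrow> 'p fm \<Rightarrow> bool"
  where
    "truth S N V s (Atom p) \<longleftrightarrow> s \<in> V p"
  | "truth S N V s (\<^bold>\<not> \<phi>) \<longleftrightarrow> \<not> truth S N V s \<phi>"
  | "truth S N V s (\<phi> \<^bold>\<and> \<psi>) \<longleftrightarrow> truth S N V s \<phi> \<and> truth S N V s \<psi>"
  | "truth S N V s (\<^bold>\<Delta> \<phi>) \<longleftrightarrow>
       {t \<in> S. truth S N V t \<phi>} \<in> N s \<or> S - {t \<in> S. truth S N V t \<phi>} \<in> N s"


subsection \<open>The proof system\<close>

text \<open>
  Propositional schemas have their own infinite supply of schematic letters: since \<^typ>\<open>'p\<close>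
  may be finite, tautologies over \<^typ>\<open>'p\<close> itself would not yield all tautological schemas.
\<close>

datatype schema = Letter nat | SNeg schema | SCon schema schema

primrec schema_eval :: "(nat \<Rightarrow> bool) \<Rightarrow> schema \<Rightarrow> bool"
  where
    "schema_eval v (Letter i) \<longleftrightarrow> v i"
  | "schema_eval v (SNeg \<alpha>) \<longleftrightarrow> \<not> schema_eval v \<alpha>"
  | "schema_eval v (SCon \<alpha> \<beta>) \<longleftrightarrow> schema_eval v \<alpha> \<and> schema_eval v \<beta>"

primrec schema_inst :: "(nat \<Rightarrow> 'p fm) \<Rightarrow> schema \<Rightarrow> 'p fm"
  where
    "schema_inst \<sigma> (Letter i) = \<sigma> i"
  | "schema_inst \<sigma> (SNeg \<alpha>) = \<^bold>\<not> schema_inst \<sigma> \<alpha>"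
  | "schema_inst \<sigma> (SCon \<alpha> \<beta>) = schema_inst \<sigma> \<alpha> \<^bold>\<and> schema_inst \<sigma> \<beta>"

definition prop_tautology :: "schema \<Rightarrow> bool"
  where "prop_tautology \<alpha> \<longleftrightarrow> (\<forall>v. schema_eval v \<alpha>)"

inductive M_Delta :: "'p fm \<Rightarrow> bool"
  where
    TAUT: "prop_tautology \<alpha> \<Longrightarrow> M_Delta (schema_inst \<sigma> \<alpha>)"
  | DeltaEqu: "M_Delta (\<^bold>\<Delta> \<phi> \<^bold>\<longleftrightarrow> \<^bold>\<Delta> (\<^bold>\<not> \<phi>))"
  | DeltaM: "M_Delta (\<^bold>\<Delta> \<phi> \<^bold>\<longrightarrow> (\<^bold>\<Delta> (\<phi> \<^bold>\<or> \<psi>) \<^bold>\<or> \<^bold>\<Delta> (\<^bold>\<not> \<phi> \<^bold>\<or> \<chi>)))"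
  | MP: "M_Delta \<phi> \<Longrightarrow> M_Delta (\<phi> \<^bold>\<longrightarrow> \<psi>) \<Longrightarrow> M_Delta \<psi>"
  | REDelta: "M_Delta (\<phi> \<^bold>\<longleftrightarrow> \<psi>) \<Longrightarrow> M_Delta (\<^bold>\<Delta> \<phi> \<^bold>\<longleftrightarrow> \<^bold>\<Delta> \<psi>)"


subsection \<open>Consistency and strong completeness\<close>

text \<open>The conjunction of \<open>\<gamma>\<close> followed by the members of a list; this covers exactly the
  nonempty finite conjunctions.\<close>

primrec conj_list :: "'p fm \<Rightarrow> 'p fm list \<Rightarrow> 'p fm"
  where
    "conj_list \<gamma> [] = \<gamma>"
  | "conj_list \<gamma> (\<delta> # \<delta>s) = \<gamma> \<^bold>\<and> conj_list \<delta> \<delta>s"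

text \<open>A system \<open>\<Lambda>\<close> is represented by its predicate of theorems.\<close>

definition consistent :: "('p fm \<Rightarrow> bool) \<Rightarrow> 'p fm set \<Rightarrow> bool"
  where "consistent \<Lambda> \<Gamma> \<longleftrightarrow>
    \<not> (\<exists>\<gamma> \<gamma>s. set (\<gamma> # \<gamma>s) \<subseteq> \<Gamma> \<and> \<Lambda> (\<^bold>\<not> conj_list \<gamma> \<gamma>s))"

text \<open>
  HOL cannot quantify existentially over types, so the type \<^typ>\<open>'s\<close> that the states are drawn
  from is a parameter of the class \<open>K\<close>. Strong completeness over one particular state type
  exhibits the required models, hence implies the statement without any restriction on states.
\<close>

definition strongly_complete :: "('p fm \<Rightarrow> bool) \<Rightarrow> 's nframe set \<Rightarrow> bool"
  where "strongly_complete \<Lambda> K \<longleftrightarrow>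
    (\<forall>\<Gamma>. consistent \<Lambda> \<Gamma> \<longrightarrow>
      (\<exists>S N V s. (S, N) \<in> K \<and> valuation_on S V \<and> s \<in> S \<and> (\<forall>\<phi>\<in>\<Gamma>. truth S N V s \<phi>)))"

end

theory Submission
  imports Defs
begin

text \<open>
  The proof is a canonical model construction. The states are the sets of formulas that
  contain all theorems and respect \<open>\<^bold>\<not>\<close> and \<open>\<^bold>\<and>\<close>, that is, the maximal consistent sets. Seen
  as valuations that treat atoms and \<open>\<^bold>\<Delta>\<close>-formulas as letters, sets respecting the connectives
  make Lindenbaum's lemma (\<open>lindenbaum\<close>) an instance of the compactness of propositional logic
  (\<open>compactness\<close>), applied to \<open>\<Gamma>\<close> together with all theorems.

  The operator \<open>\<^bold>\<Delta>\<close> does not tell which of \<open>\<phi>\<close> and its negation is responsible for the truth of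
  \<open>\<^bold>\<Delta> \<phi>\<close>, so \<open>\<^bold>\<Delta> \<phi> \<in> s\<close> cannot simply put the truth set \<open>|\<phi>|\<close> of \<open>\<phi>\<close> among the neighborhoods
  of \<open>s\<close>. In a monotone frame, however, a neighborhood \<open>|\<phi>|\<close> makes \<open>\<^bold>\<Delta> (\<phi> \<^bold>\<or> \<psi>)\<close> true for every
  \<open>\<psi>\<close>. This property serves as the definition: the neighborhoods of \<open>s\<close> are the supersets of the
  sets \<open>|\<phi>|\<close> with \<open>\<^bold>\<Delta> (\<phi> \<^bold>\<or> \<psi>) \<in> s\<close> for all \<open>\<psi>\<close>, which makes monotonicity immediate. Axiom
  \<open>\<Delta>M\<close> says exactly that whenever \<open>\<^bold>\<Delta> \<phi> \<in> s\<close>, at least one of \<open>\<phi>\<close> and \<open>\<^bold>\<not> \<phi>\<close> has the property.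
  Conversely, a neighborhood that is itself of the form \<open>|\<phi>|\<close> yields \<open>\<^bold>\<Delta> \<phi> \<in> s\<close>: if
  \<open>|\<chi>| \<subseteq> |\<phi>|\<close>, then \<open>\<chi> \<^bold>\<or> \<phi>\<close> and \<open>\<phi>\<close> are provably equivalent, and the rule \<open>RE\<Delta>\<close> applies.
  These two facts give the truth lemma.
\<close>

section \<open>Formulas as propositional formulas\<close>

text \<open>
  Such a set \<open>W\<close> is a propositional valuation in disguise: membership of atoms and
  \<open>\<^bold>\<Delta>\<close>-formulas is arbitrary and determines membership of everything else.
\<close>

definition boolean_set :: "'p fm set \<Rightarrow> bool"
  where "boolean_set W \<longleftrightarrow>
    (\<forall>\<phi>. \<^bold>\<not> \<phi> \<in> W \<longleftrightarrow> \<phi> \<notin> W) \<and> (\<forall>\<phi> \<psi>. \<phi> \<^bold>\<and> \<psi> \<in> W \<longleftrightarrow> \<phi> \<in> W \<and> \<psi> \<in> W)"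

lemma boolean_set_Neg: "boolean_set W \<Longrightarrow> \<^bold>\<not> \<phi> \<in> W \<longleftrightarrow> \<phi> \<notin> W"
  and boolean_set_Con: "boolean_set W \<Longrightarrow> \<phi> \<^bold>\<and> \<psi> \<in> W \<longleftrightarrow> \<phi> \<in> W \<and> \<psi> \<in> W"
  by (auto simp: boolean_set_def)

lemmas boolean_set_iffs = boolean_set_Neg boolean_set_Con

lemma boolean_set_conj_list:
  "boolean_set W \<Longrightarrow> conj_list \<gamma> \<gamma>s \<in> W \<longleftrightarrow> set (\<gamma> # \<gamma>s) \<subseteq> W"
  by (induction \<gamma>s arbitrary: \<gamma>) (auto simp: boolean_set_iffs)

primrec skeleton :: "('p fm \<Rightarrow> nat) \<Rightarrow> 'p fm \<Rightarrow> schema"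
  where
    "skeleton f (Atom p) = Letter (f (Atom p))"
  | "skeleton f (\<^bold>\<not> \<phi>) = SNeg (skeleton f \<phi>)"
  | "skeleton f (\<phi> \<^bold>\<and> \<psi>) = SCon (skeleton f \<phi>) (skeleton f \<psi>)"
  | "skeleton f (\<^bold>\<Delta> \<phi>) = Letter (f (\<^bold>\<Delta> \<phi>))"

primrec prime_parts :: "'p fm \<Rightarrow> 'p fm set"
  where
    "prime_parts (Atom p) = {Atom p}"
  | "prime_parts (\<^bold>\<not> \<phi>) = prime_parts \<phi>"
  | "prime_parts (\<phi> \<^bold>\<and> \<psi>) = prime_parts \<phi> \<union> prime_parts \<psi>"
  | "prime_parts (\<^bold>\<Delta> \<phi>) = {\<^bold>\<Delta> \<phi>}"

lemma finite_prime_parts: "finite (prime_parts \<phi>)"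
  by (induction \<phi>) auto

lemma schema_inst_skeleton:
  "(\<And>\<chi>. \<chi> \<in> prime_parts \<phi> \<Longrightarrow> \<sigma> (f \<chi>) = \<chi>) \<Longrightarrow> schema_inst \<sigma> (skeleton f \<phi>) = \<phi>"
  by (induction \<phi>) auto

lemma boolean_set_schema_eval: "boolean_set {\<psi>. schema_eval v (skeleton f \<psi>)}"
  by (auto simp: boolean_set_def)

text \<open>
  Numbering the finitely many prime parts of \<open>\<phi>\<close> exhibits \<open>\<phi>\<close> as an instance of a schema, and
  every valuation of that schema induces a set respecting the connectives.
\<close>

lemma M_Delta_tautology:
  assumes "\<And>W. boolean_set W \<Longrightarrow> \<phi> \<in> W"
  shows "M_Delta \<phi>"
proof -
  obtain f :: "'a fm \<Rightarrow> nat" where f: "inj_on f (prime_parts \<phi>)"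
    using finite_imp_inj_to_nat_seg[OF finite_prime_parts] by blast
  have "prop_tautology (skeleton f \<phi>)"
    using assms[OF boolean_set_schema_eval] by (auto simp: prop_tautology_def)
  moreover have "schema_inst (inv_into (prime_parts \<phi>) f) (skeleton f \<phi>) = \<phi>"
    by (rule schema_inst_skeleton) (simp add: f)
  ultimately show ?thesis
    by (metis M_Delta.TAUT)
qed

lemma M_Delta_tautological_consequence:
  assumes "finite A" "A \<subseteq> Collect M_Delta"
    and "\<And>W. boolean_set W \<Longrightarrow> A \<subseteq> W \<Longrightarrow> \<phi> \<in> W"
  shows "M_Delta \<phi>"
  using assms
proof (induction A arbitrary: \<phi> rule: finite_induct)
  case empty
  then show ?case by (simp add: M_Delta_tautology)
next
  case (insert a A)
  have "M_Delta (a \<^bold>\<longrightarrow> \<phi>)"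
    using insert.prems by (intro insert.IH) (auto simp: boolean_set_iffs)
  with insert.prems show ?case
    by (auto intro: M_Delta.MP)
qed

section \<open>Compactness and maximal consistent sets\<close>

definition finitely_satisfiable :: "'p fm set \<Rightarrow> bool"
  where "finitely_satisfiable X \<longleftrightarrow> (\<forall>A\<subseteq>X. finite A \<longrightarrow> (\<exists>W. boolean_set W \<and> A \<subseteq> W))"

text \<open>
  A finite set refuting one extension and a finite set refuting the other combine, after removal
  of \<open>\<phi>\<close> and \<open>\<^bold>\<not> \<phi>\<close>, into a finite subset of \<open>X\<close> without a valuation.
\<close>

lemma finitely_satisfiable_insert:
  assumes "finitely_satisfiable X"
  shows "finitely_satisfiable (insert \<phi> X) \<or> finitely_satisfiable (insert (\<^bold>\<not> \<phi>) X)"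
proof (rule ccontr)
  assume "\<not> ?thesis"
  then obtain A B where A: "A \<subseteq> insert \<phi> X" "finite A" "\<And>W. boolean_set W \<Longrightarrow> \<not> A \<subseteq> W"
    and B: "B \<subseteq> insert (\<^bold>\<not> \<phi>) X" "finite B" "\<And>W. boolean_set W \<Longrightarrow> \<not> B \<subseteq> W"
    unfolding finitely_satisfiable_def by blast
  let ?C = "(A - {\<phi>}) \<union> (B - {\<^bold>\<not> \<phi>})"
  have "?C \<subseteq> X" "finite ?C"
    using A B by auto
  with assms obtain W where W: "boolean_set W" "?C \<subseteq> W"
    unfolding finitely_satisfiable_def by blast
  show False
  proof (cases "\<phi> \<in> W")
    case True
    with W A(3)[OF W(1)] show False by blast
  next
    case False
    with W B(3)[OF W(1)] show False by (auto simp: boolean_set_Neg)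
  qed
qed

text \<open>
  A maximal finitely satisfiable set is itself a valuation: it decides every formula, and any
  violation of the conditions for \<open>\<^bold>\<not>\<close> and \<open>\<^bold>\<and>\<close> is witnessed by at most three of its members.
\<close>

theorem compactness:
  assumes "finitely_satisfiable X"
  obtains W where "boolean_set W" "X \<subseteq> W"
proof -
  let ?F = "{Y. X \<subseteq> Y \<and> finitely_satisfiable Y}"
  have "\<exists>M\<in>?F. \<forall>Y\<in>?F. M \<subseteq> Y \<longrightarrow> Y = M"
  proof (rule subset_Zorn_nonempty)
    show "?F \<noteq> {}" using assms by blast
  next
    fix C assume C: "C \<noteq> {}" "subset.chain ?F C"
    have "finitely_satisfiable (\<Union>C)"
      unfolding finitely_satisfiable_def
    proof (intro allI impI)
      fix A assume "A \<subseteq> \<Union>C" "finite A"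
      then obtain Y where "Y \<in> C" "A \<subseteq> Y"
        using finite_subset_Union_chain C by metis
      with C(2) \<open>finite A\<close> show "\<exists>W. boolean_set W \<and> A \<subseteq> W"
        by (auto simp: subset.chain_def finitely_satisfiable_def)
    qed
    moreover have "X \<subseteq> \<Union>C"
      using C unfolding subset.chain_def by blast
    ultimately show "\<Union>C \<in> ?F" by simp
  qed
  then obtain M where "X \<subseteq> M" and fs: "finitely_satisfiable M"
    and max: "\<And>Y. finitely_satisfiable Y \<Longrightarrow> M \<subseteq> Y \<Longrightarrow> Y = M"
    by (smt (verit) mem_Collect_eq subset_trans)
  have decides: "\<phi> \<in> M \<or> \<^bold>\<not> \<phi> \<in> M" for \<phi>
    using finitely_satisfiable_insert[OF fs, of \<phi>] max by blast
  have sat: "\<exists>W. boolean_set W \<and> A \<subseteq> W" if "A \<subseteq> M" "finite A" for A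
    using fs that by (auto simp: finitely_satisfiable_def)
  have no_clash: "\<not> (\<phi> \<in> M \<and> \<^bold>\<not> \<phi> \<in> M)" for \<phi>
    using sat[of "{\<phi>, \<^bold>\<not> \<phi>}"] by (auto simp: boolean_set_Neg)
  moreover have "\<phi> \<^bold>\<and> \<psi> \<in> M \<longleftrightarrow> \<phi> \<in> M \<and> \<psi> \<in> M" for \<phi> \<psi>
  proof -
    have "\<not> {\<phi> \<^bold>\<and> \<psi>, \<^bold>\<not> \<phi>} \<subseteq> M" "\<not> {\<phi> \<^bold>\<and> \<psi>, \<^bold>\<not> \<psi>} \<subseteq> M" "\<not> {\<phi>, \<psi>, \<^bold>\<not> (\<phi> \<^bold>\<and> \<psi>)} \<subseteq> M"
      using sat[of "{\<phi> \<^bold>\<and> \<psi>, \<^bold>\<not> \<phi>}"] sat[of "{\<phi> \<^bold>\<and> \<psi>, \<^bold>\<not> \<psi>}"]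
        sat[of "{\<phi>, \<psi>, \<^bold>\<not> (\<phi> \<^bold>\<and> \<psi>)}"]
      by (auto simp: boolean_set_iffs)
    with decides show ?thesis by blast
  qed
  ultimately have "boolean_set M"
    using decides by (auto simp: boolean_set_def)
  with \<open>X \<subseteq> M\<close> show ?thesis by (rule that[rotated])
qed

definition mcs :: "'p fm set set"
  where "mcs = {W. boolean_set W \<and> Collect M_Delta \<subseteq> W}"

lemma mcs_Neg: "W \<in> mcs \<Longrightarrow> \<^bold>\<not> \<phi> \<in> W \<longleftrightarrow> \<phi> \<notin> W"
  and mcs_Con: "W \<in> mcs \<Longrightarrow> \<phi> \<^bold>\<and> \<psi> \<in> W \<longleftrightarrow> \<phi> \<in> W \<and> \<psi> \<in> W"
  and mcs_M_Delta: "W \<in> mcs \<Longrightarrow> M_Delta \<phi> \<Longrightarrow> \<phi> \<in> W"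
  by (auto simp: mcs_def boolean_set_iffs)

lemmas mcs_iffs = mcs_Neg mcs_Con

text \<open>
  The hypothesis \<open>\<Gamma> \<noteq> {}\<close> matters because only nonempty conjunctions enter into consistency:
  the empty set is consistent in every system, even one that proves everything.
\<close>

lemma lindenbaum:
  assumes cons: "consistent M_Delta \<Gamma>" and "\<Gamma> \<noteq> {}"
  obtains W where "W \<in> mcs" "\<Gamma> \<subseteq> W"
proof -
  have "finitely_satisfiable (\<Gamma> \<union> Collect M_Delta)"
    unfolding finitely_satisfiable_def
  proof (intro allI impI)
    fix A assume A: "A \<subseteq> \<Gamma> \<union> Collect M_Delta" "finite A"
    obtain \<gamma> where "\<gamma> \<in> \<Gamma>" using \<open>\<Gamma> \<noteq> {}\<close> by blast
    have "finite (A \<inter> \<Gamma>)" using A by simp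
    then obtain \<gamma>s where \<gamma>s: "set \<gamma>s = A \<inter> \<Gamma>"
      using finite_list by blast
    show "\<exists>W. boolean_set W \<and> A \<subseteq> W"
    proof (rule ccontr)
      assume unsat: "\<nexists>W. boolean_set W \<and> A \<subseteq> W"
      have "M_Delta (\<^bold>\<not> conj_list \<gamma> \<gamma>s)"
      proof (rule M_Delta_tautological_consequence)
        show "finite (A - \<Gamma>)" "A - \<Gamma> \<subseteq> Collect M_Delta" using A by auto
      next
        fix W assume W: "boolean_set W" "A - \<Gamma> \<subseteq> W"
        with unsat have "\<not> A \<inter> \<Gamma> \<subseteq> W" by blast
        with \<gamma>s show "\<^bold>\<not> conj_list \<gamma> \<gamma>s \<in> W"
          by (simp add: boolean_set_Neg[OF W(1)] boolean_set_conj_list[OF W(1)])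
      qed
      moreover have "set (\<gamma> # \<gamma>s) \<subseteq> \<Gamma>" using \<gamma>s \<open>\<gamma> \<in> \<Gamma>\<close> by simp
      ultimately show False using cons unfolding consistent_def by blast
    qed
  qed
  then obtain W where "boolean_set W" "\<Gamma> \<union> Collect M_Delta \<subseteq> W"
    by (rule compactness)
  then show ?thesis using that by (auto simp: mcs_def)
qed

lemma M_Delta_if_in_all_mcs:
  assumes all: "\<And>W. W \<in> mcs \<Longrightarrow> \<phi> \<in> W"
  shows "M_Delta \<phi>"
proof (rule ccontr)
  assume unprovable: "\<not> M_Delta \<phi>"
  have "consistent M_Delta {\<^bold>\<not> \<phi>}"
    unfolding consistent_def
  proof (intro notI, elim exE conjE)
    fix \<gamma> \<gamma>s assume sub: "set (\<gamma> # \<gamma>s) \<subseteq> {\<^bold>\<not> \<phi>}" and "M_Delta (\<^bold>\<not> conj_list \<gamma> \<gamma>s)"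
    have "M_Delta \<phi>"
    proof (rule M_Delta_tautological_consequence)
      show "finite {\<^bold>\<not> conj_list \<gamma> \<gamma>s}" by simp
      show "{\<^bold>\<not> conj_list \<gamma> \<gamma>s} \<subseteq> Collect M_Delta"
        using \<open>M_Delta (\<^bold>\<not> conj_list \<gamma> \<gamma>s)\<close> by simp
    next
      fix W assume W: "boolean_set W" "{\<^bold>\<not> conj_list \<gamma> \<gamma>s} \<subseteq> W"
      then have "\<not> set (\<gamma> # \<gamma>s) \<subseteq> W"
        using boolean_set_Neg[OF W(1)] boolean_set_conj_list[OF W(1)] by blast
      with sub have "\<^bold>\<not> \<phi> \<notin> W" by blast
      with W(1) show "\<phi> \<in> W" by (simp add: boolean_set_Neg)
    qed
    with unprovable show False by contradiction
  qed
  then obtain W where "W \<in> mcs" "{\<^bold>\<not> \<phi>} \<subseteq> W"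
    using lindenbaum by blast
  with all show False by (auto simp: mcs_Neg)
qed

section \<open>The canonical monotone model\<close>

definition proof_set :: "'p fm \<Rightarrow> 'p fm set set"
  where "proof_set \<phi> = {W \<in> mcs. \<phi> \<in> W}"

definition canonical_nbhd :: "'p fm set \<Rightarrow> 'p fm set set set"
  where "canonical_nbhd s =
    {X. X \<subseteq> mcs \<and> (\<exists>\<phi>. proof_set \<phi> \<subseteq> X \<and> (\<forall>\<psi>. \<^bold>\<Delta> (\<phi> \<^bold>\<or> \<psi>) \<in> s))}"

lemma canonical_m_frame:
  assumes "(mcs :: 'p fm set set) \<noteq> {}"
  shows "(mcs, canonical_nbhd) \<in> (m_frames :: 'p fm set nframe set)"
proof -
  have "Y \<in> canonical_nbhd s" if "X \<in> canonical_nbhd s" "X \<subseteq> Y" "Y \<subseteq> mcs" for s X Y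
    using that unfolding canonical_nbhd_def mem_Collect_eq by (meson subset_trans)
  moreover have "canonical_nbhd s \<subseteq> Pow mcs" for s
    by (auto simp: canonical_nbhd_def)
  ultimately show ?thesis
    using assms by (simp add: m_frames_def nbhd_frames_def) blast
qed

lemma mcs_minus_proof_set: "mcs - proof_set \<phi> = proof_set (\<^bold>\<not> \<phi>)"
  by (auto simp: proof_set_def mcs_Neg)

lemma mcs_Delta_cong:
  assumes "s \<in> mcs" "proof_set \<phi> = proof_set \<psi>"
  shows "\<^bold>\<Delta> \<phi> \<in> s \<longleftrightarrow> \<^bold>\<Delta> \<psi> \<in> s"
proof -
  have "M_Delta (\<phi> \<^bold>\<longleftrightarrow> \<psi>)"
    using assms(2) by (intro M_Delta_if_in_all_mcs) (auto simp: mcs_iffs proof_set_def)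
  then have "(\<^bold>\<Delta> \<phi> \<^bold>\<longleftrightarrow> \<^bold>\<Delta> \<psi>) \<in> s"
    by (intro mcs_M_Delta[OF assms(1)] M_Delta.REDelta)
  with assms(1) show ?thesis by (auto simp: mcs_iffs)
qed

lemma mcs_Delta_Neg:
  assumes "s \<in> mcs"
  shows "\<^bold>\<Delta> (\<^bold>\<not> \<phi>) \<in> s \<longleftrightarrow> \<^bold>\<Delta> \<phi> \<in> s"
  using mcs_M_Delta[OF assms M_Delta.DeltaEqu[of \<phi>]] assms by (auto simp: mcs_iffs)

text \<open>
  Any witness \<open>\<chi>\<close> has \<open>|\<chi>| \<subseteq> |\<phi>|\<close>, so the disjunct \<open>\<phi>\<close> added to it absorbs it.
\<close>

lemma Delta_if_proof_set_canonical_nbhd: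
  assumes s: "s \<in> mcs" and "proof_set \<phi> \<in> canonical_nbhd s"
  shows "\<^bold>\<Delta> \<phi> \<in> s"
proof -
  obtain \<chi> where \<chi>: "proof_set \<chi> \<subseteq> proof_set \<phi>" "\<^bold>\<Delta> (\<chi> \<^bold>\<or> \<phi>) \<in> s"
    using assms(2) by (auto simp: canonical_nbhd_def)
  have "proof_set (\<chi> \<^bold>\<or> \<phi>) = proof_set \<phi>"
    using \<chi>(1) by (auto simp: proof_set_def mcs_iffs)
  with \<chi>(2) mcs_Delta_cong[OF s] show ?thesis by blast
qed

text \<open>
  If neither set were a neighborhood through its own formula, some \<open>\<psi>\<close> and \<open>\<chi>\<close> would refute both
  disjuncts on the right-hand side of \<open>\<Delta>M\<close>.
\<close>

lemma proof_set_canonical_nbhd_if_Delta: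
  assumes s: "s \<in> mcs" and "\<^bold>\<Delta> \<phi> \<in> s"
  shows "proof_set \<phi> \<in> canonical_nbhd s \<or> proof_set (\<^bold>\<not> \<phi>) \<in> canonical_nbhd s"
proof -
  have "\<^bold>\<Delta> (\<phi> \<^bold>\<or> \<psi>) \<in> s \<or> \<^bold>\<Delta> (\<^bold>\<not> \<phi> \<^bold>\<or> \<chi>) \<in> s" for \<psi> \<chi>
    using mcs_M_Delta[OF s M_Delta.DeltaM[of \<phi> \<psi> \<chi>]] assms by (simp add: mcs_iffs)
  then have "(\<forall>\<psi>. \<^bold>\<Delta> (\<phi> \<^bold>\<or> \<psi>) \<in> s) \<or> (\<forall>\<chi>. \<^bold>\<Delta> (\<^bold>\<not> \<phi> \<^bold>\<or> \<chi>) \<in> s)"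
    by blast
  moreover have "proof_set \<theta> \<in> canonical_nbhd s" if "\<forall>\<psi>. \<^bold>\<Delta> (\<theta> \<^bold>\<or> \<psi>) \<in> s" for \<theta>
    using that by (auto simp: canonical_nbhd_def proof_set_def)
  ultimately show ?thesis by blast
qed

lemma truth_lemma:
  "s \<in> mcs \<Longrightarrow> truth mcs canonical_nbhd (\<lambda>p. proof_set (Atom p)) s \<phi> \<longleftrightarrow> \<phi> \<in> s"
proof (induction \<phi> arbitrary: s)
  case (Atom p)
  then show ?case by (simp add: proof_set_def)
next
  case (Neg \<phi>)
  then show ?case by (simp add: mcs_Neg)
next
  case (Con \<phi> \<psi>)
  then show ?case by (simp add: mcs_Con)
next
  case (Delta \<phi>)
  have "{t \<in> mcs. truth mcs canonical_nbhd (\<lambda>p. proof_set (Atom p)) t \<phi>} = proof_set \<phi>"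
    using Delta.IH by (auto simp: proof_set_def)
  then have "truth mcs canonical_nbhd (\<lambda>p. proof_set (Atom p)) s (\<^bold>\<Delta> \<phi>) \<longleftrightarrow>
      proof_set \<phi> \<in> canonical_nbhd s \<or> proof_set (\<^bold>\<not> \<phi>) \<in> canonical_nbhd s"
    by (simp add: mcs_minus_proof_set)
  also have "\<dots> \<longleftrightarrow> \<^bold>\<Delta> \<phi> \<in> s"
    using proof_set_canonical_nbhd_if_Delta[OF Delta.prems]
      Delta_if_proof_set_canonical_nbhd[OF Delta.prems] mcs_Delta_Neg[OF Delta.prems] by blast
  finally show ?case .
qed

theorem theorem17:
  shows "strongly_complete (M_Delta :: 'p fm \<Rightarrow> bool) (m_frames :: 'p fm set nframe set)"
  unfolding strongly_complete_def
proof (intro allI impI)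
  fix \<Gamma> :: "'p fm set"
  assume cons: "consistent M_Delta \<Gamma>"
  show "\<exists>(S :: 'p fm set set) N V s. (S, N) \<in> m_frames \<and> valuation_on S V \<and> s \<in> S \<and>
    (\<forall>\<phi>\<in>\<Gamma>. truth S N V s \<phi>)"
  proof (cases "\<Gamma> = {}")
    case True
    \<comment> \<open>Any model will do; a one-point model avoids having to show that \<open>mcs\<close> is nonempty,
      which amounts to the consistency of the system.\<close>
    have "({{}}, \<lambda>_. {}) \<in> (m_frames :: 'p fm set nframe set)"
      by (simp add: m_frames_def nbhd_frames_def)
    moreover have "valuation_on {{}} (\<lambda>_. {})"
      by (simp add: valuation_on_def)
    ultimately show ?thesis using True by blast
  next
    case False
    with cons obtain s where s: "s \<in> mcs" "\<Gamma> \<subseteq> s"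
      using lindenbaum by blast
    then have "\<forall>\<phi>\<in>\<Gamma>. truth mcs canonical_nbhd (\<lambda>p. proof_set (Atom p)) s \<phi>"
      by (auto simp: truth_lemma)
    moreover have "(mcs, canonical_nbhd) \<in> (m_frames :: 'p fm set nframe set)"
      using s(1) canonical_m_frame by blast
    moreover have "valuation_on mcs (\<lambda>p :: 'p. proof_set (Atom p))"
      by (auto simp: valuation_on_def proof_set_def)
    ultimately show ?thesis using s(1) by blast
  qed
qed

end
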